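(* Let $\mathcal{F}$ be a family of finite graphs with $\chi(\mathcal{F})\ge 2$, and let $F\in\mathcal{F}$ be a graph with chromatic number $\chi(\mathcal{F})$ and independence number $\alpha(\mathcal{F})$. For every $\varepsilon>0$ and every finite comparability graph $G$, if $t(F,G)\le\left(\frac{\varepsilon}{2}\right)^{\chi(\mathcal{F})\,\alpha(\mathcal{F})^2}$, then there exists an $\mathcal{F}$-free (moreover, $K_{\chi(\mathcal{F})}$-free) spanning subgraph of $G$ that is a comparability graph, obtained by deleting at most $\varepsilon|V(G)|^2$ edges.
   Context: Graphs are simple and undirected. The comparability graph of a poset $(P,\prec)$ (where $\prec$ is anti-reflexive and transitive) is the graph with vertex set $P$ in which $x,y$ are adjacent iff $x\prec y$ or $y\prec x$; a comparability graph is a graph arising in this way from some poset. $\chi(F)$ is the chromatic number and $\alpha(F)$ the independence number of $F$; $K_r$ is the complete graph on $r$ vertices. For a (possibly infinite) family $\mathcal{F}$ of finite graphs, $\chi(\mathcal{F})=\min_{F\in\mathcal{F}}\chi(F)$ and $\alpha(\mathcal{F})=\min\{\alpha(F):F\in\mathcal{F},\ \chi(F)=\chi(\mathcal{F})\}$. $t(F,G)$ is the probability that a uniformly random mapping $V(F)\to V(G)$ is a graph homomorphism (edge-preserving). $G$ is $F$-free if it has no (not necessarily induced) subgraph isomorphic to $F$, and $\mathcal{F}$-free if it is $F$-free for every $F\in\mathcal{F}$. *)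

theory Defs
  imports "HOL-Analysis.Analysis"
begin

datatype 'a sgraph = SGraph (verts: "'a set") (edges: "'a set set")

definition simple_graph :: "'a sgraph \<Rightarrow> bool" where
  "simple_graph G \<longleftrightarrow> (\<forall>e\<in>edges G. e \<subseteq> verts G \<and> card e = 2)"

definition finite_simple_graph :: "'a sgraph \<Rightarrow> bool" where
  "finite_simple_graph G \<longleftrightarrow> simple_graph G \<and> finite (verts G)"

definition adj :: "'a sgraph \<Rightarrow> 'a \<Rightarrow> 'a \<Rightarrow> bool" where
  "adj G x y \<longleftrightarrow> {x, y} \<in> edges G"

definition complete_graph :: "nat \<Rightarrow> nat sgraph" where
  "complete_graph r = SGraph {..<r} {e. e \<subseteq> {..<r} \<and> card e = 2}"

definition poset_graph :: "'a set \<Rightarrow> ('a \<Rightarrow> 'a \<Rightarrow> bool) \<Rightarrow> 'a sgraph" where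
  "poset_graph P R = SGraph P {{x, y} | x y. x \<in> P \<and> y \<in> P \<and> (R x y \<or> R y x)}"

definition comparability_graph :: "'a sgraph \<Rightarrow> bool" where
  "comparability_graph G \<longleftrightarrow>
     (\<exists>P R. irreflp_on P R \<and> transp_on P R \<and> G = poset_graph P R)"

definition proper_colouring :: "'a sgraph \<Rightarrow> nat \<Rightarrow> ('a \<Rightarrow> nat) \<Rightarrow> bool" where
  "proper_colouring G k c \<longleftrightarrow>
     (\<forall>x\<in>verts G. c x < k) \<and> (\<forall>x\<in>verts G. \<forall>y\<in>verts G. adj G x y \<longrightarrow> c x \<noteq> c y)"

definition chromatic_number :: "'a sgraph \<Rightarrow> nat" where
  "chromatic_number G = (LEAST k. \<exists>c. proper_colouring G k c)"

definition independent_set :: "'a sgraph \<Rightarrow> 'a set \<Rightarrow> bool" where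
  "independent_set G S \<longleftrightarrow> S \<subseteq> verts G \<and> (\<forall>x\<in>S. \<forall>y\<in>S. \<not> adj G x y)"

definition independence_number :: "'a sgraph \<Rightarrow> nat" where
  "independence_number G = Max (card ` {S. independent_set G S})"

text \<open>\<^const>\<open>Inf\<close> on \<^typ>\<open>nat\<close> is the minimum of a nonempty set, whether or not the set is
  finite, so the families below may be infinite. The values for the empty family are irrelevant.\<close>

definition family_chromatic_number :: "'a sgraph set \<Rightarrow> nat" where
  "family_chromatic_number \<F> = Inf (chromatic_number ` \<F>)"

definition family_independence_number :: "'a sgraph set \<Rightarrow> nat" where
  "family_independence_number \<F> =
     Inf (independence_number ` {F\<in>\<F>. chromatic_number F = family_chromatic_number \<F>})"

definition graph_hom :: "'a sgraph \<Rightarrow> 'b sgraph \<Rightarrow> ('a \<Rightarrow> 'b) \<Rightarrow> bool" where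
  "graph_hom F G f \<longleftrightarrow>
     f ` verts F \<subseteq> verts G \<and>
     (\<forall>x\<in>verts F. \<forall>y\<in>verts F. adj F x y \<longrightarrow> adj G (f x) (f y))"

text \<open>If \<^term>\<open>verts G\<close> is empty and \<^term>\<open>verts F\<close> is not, there are no mappings
  and the density is 0.\<close>

definition hom_density :: "'a sgraph \<Rightarrow> 'b sgraph \<Rightarrow> real" where
  "hom_density F G =
     measure (uniform_count_measure (verts F \<rightarrow>\<^sub>E verts G))
       {f \<in> verts F \<rightarrow>\<^sub>E verts G. graph_hom F G f}"

definition subgraph :: "'a sgraph \<Rightarrow> 'a sgraph \<Rightarrow> bool" where
  "subgraph H G \<longleftrightarrow> simple_graph H \<and> verts H \<subseteq> verts G \<and> edges H \<subseteq> edges G"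

definition spanning_subgraph :: "'a sgraph \<Rightarrow> 'a sgraph \<Rightarrow> bool" where
  "spanning_subgraph H G \<longleftrightarrow> subgraph H G \<and> verts H = verts G"

definition graph_isomorphic :: "'a sgraph \<Rightarrow> 'b sgraph \<Rightarrow> bool" where
  "graph_isomorphic F H \<longleftrightarrow>
     (\<exists>f. bij_betw f (verts F) (verts H) \<and>
          (\<forall>x\<in>verts F. \<forall>y\<in>verts F. adj F x y \<longleftrightarrow> adj H (f x) (f y)))"

definition graph_free :: "'a sgraph \<Rightarrow> 'b sgraph \<Rightarrow> bool" where
  "graph_free F G \<longleftrightarrow> \<not> (\<exists>H. subgraph H G \<and> graph_isomorphic F H)"

definition family_free :: "'a sgraph set \<Rightarrow> 'b sgraph \<Rightarrow> bool" where
  "family_free \<F> G \<longleftrightarrow> (\<forall>F\<in>\<F>. graph_free F G)"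

end

theory Submission
  imports Defs
begin

text \<open>Put \<open>k = \<chi>(\<F>)\<close>, \<open>m = \<alpha>(\<F>)\<close>, \<open>\<delta> = \<epsilon> / 2\<close> and let \<open>G\<close> be the comparability
  graph of an order \<open>R\<close> on \<open>n\<close> points. The proof is a robust form of Mirsky's theorem that a poset
  of height less than \<open>k\<close> splits into \<open>k - 1\<close> antichains. Let \<open>L\<^sub>0\<close> be the whole poset, and let
  \<open>L\<^bsub>j+1\<^esub>\<close> consist of the points with at least \<open>\<delta>n\<close> elements of \<open>L\<^sub>j\<close> below them. These sets
  are decreasing up-sets, and the level of a point is the largest \<open>j\<close> with the point in \<open>L\<^sub>j\<close>.

  If \<open>L\<^bsub>k-1\<^esub>\<close> has at most \<open>\<delta>n\<close> points, isolate those points and, among the others, keep only the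
  relations along which the level strictly increases. What remains is again a strict order, and the
  levels \<open>0, \<dots>, k - 2\<close> colour its comparability graph properly, so that this graph contains neither
  \<open>K\<^sub>k\<close> nor any member of \<open>\<F>\<close>. At most \<open>\<delta>n\<^sup>2\<close> pairs are lost by isolating \<open>L\<^bsub>k-1\<^esub>\<close>, and at most
  \<open>\<delta>n\<close> for every other point, because a point of level \<open>j\<close> fails to lie in \<open>L\<^bsub>j+1\<^esub>\<close>. This is
  \<open>comparability_removal\<close>.

  If \<open>L\<^bsub>k-1\<^esub>\<close> is larger, walking down from it level by level gives more than \<open>(\<delta>n)\<^sup>k\<close> chains of length
  \<open>k\<close> (\<open>many_chains\<close>). These force many chains in which each point is replaced by \<open>m\<close> points. By
  transitivity only consecutive blocks have to be compared, so a chain may be treated as a path, and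
  a path is bipartite: a chain is a related pair consisting of its restriction to even positions and
  its restriction to odd positions. Blowing up the two sides one after the other raises the density
  \<open>p\<close> of chains to \<open>p\<^sup>m\<close> and then to \<open>p\<close> to the power \<open>m\<^sup>2\<close>, by convexity
  (\<open>many_chain_blow_ups\<close>). A proper \<open>k\<close>-colouring of \<open>F\<close> has classes of size at most \<open>m\<close>, so
  \<open>F\<close> embeds into the complete \<open>k\<close>-partite graph with parts of size \<open>m\<close>, and \<open>t(F,G)\<close> is at least
  the density of blown-up chains (\<open>hom_density_ge_power\<close>). This density exceeds \<open>\<delta>\<close> to the power
  \<open>km\<^sup>2\<close>, against the assumption.\<close>

section \<open>Tuples in dense bipartite relations\<close>

text \<open>Convexity of the power function in division-free form; it serves as Jensen's inequality
  below, with \<open>t\<close> a lower bound for the average.\<close>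

lemma power_above_tangent:
  fixes x t :: real
  assumes "0 \<le> x" "0 \<le> t"
  shows "t ^ m + real m * t ^ (m - 1) * (x - t) \<le> x ^ m"
proof (induction m)
  case 0
  show ?case by simp
next
  case (Suc m)
  have "x ^ Suc m - (t ^ Suc m + real (Suc m) * t ^ m * (x - t))
      = x * (x ^ m - (t ^ m + real m * t ^ (m - 1) * (x - t))) + real m * t ^ (m - 1) * (x - t)\<^sup>2"
    by (cases m) (simp_all add: algebra_simps power2_eq_square)
  moreover have "0 \<le> x * (x ^ m - (t ^ m + real m * t ^ (m - 1) * (x - t)))"
    using Suc assms by simp
  moreover have "0 \<le> real m * t ^ (m - 1) * (x - t)\<^sup>2"
    using assms by simp
  ultimately show ?case by simp
qed

text \<open>The left-hand count is the \<open>m\<close>-th moment of the degrees of the points of \<open>A\<close>, whose mean is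
  at least \<open>p |B|\<close>.\<close>

lemma blow_up_right_side:
  fixes A :: "'a set" and B :: "'b set" and p :: real
  assumes "finite A" "finite B" "Q \<subseteq> A \<times> B" "0 \<le> p"
    and dense: "p * card A * card B \<le> card Q"
  shows "p ^ m * card A * real (card B) ^ m
    \<le> card {(a, b). a \<in> A \<and> b \<in> {..<m} \<rightarrow>\<^sub>E B \<and> (\<forall>i<m. (a, b i) \<in> Q)}"
proof -
  define D where "D a = {b \<in> B. (a, b) \<in> Q}" for a
  define t where "t = p * card B"
  have finD: "finite (D a)" for a
    using assms(2) by (simp add: D_def)
  have "b \<in> {..<m} \<rightarrow>\<^sub>E D a \<longleftrightarrow> b \<in> {..<m} \<rightarrow>\<^sub>E B \<and> (\<forall>i<m. (a, b i) \<in> Q)" for a b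
    unfolding PiE_iff D_def by blast
  then have "{(a, b). a \<in> A \<and> b \<in> {..<m} \<rightarrow>\<^sub>E B \<and> (\<forall>i<m. (a, b i) \<in> Q)}
      = (SIGMA a:A. {..<m} \<rightarrow>\<^sub>E D a)"
    by blast
  then have count: "real (card {(a, b). a \<in> A \<and> b \<in> {..<m} \<rightarrow>\<^sub>E B \<and> (\<forall>i<m. (a, b i) \<in> Q)})
      = (\<Sum>a\<in>A. real (card (D a)) ^ m)"
    using assms(1) finD by (simp add: card_SigmaI finite_PiE card_PiE)
  have "Q = (SIGMA a:A. D a)"
    using assms(3) by (auto simp: D_def)
  then have cardQ: "real (card Q) = (\<Sum>a\<in>A. real (card (D a)))"
    using assms(1) finD by (simp add: card_SigmaI)
  have t: "0 \<le> t" "card A * t \<le> card Q"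
    using assms by (simp_all add: t_def mult_ac)
  have "p ^ m * card A * real (card B) ^ m = card A * t ^ m"
    by (simp add: t_def power_mult_distrib)
  also have "\<dots> \<le> card A * t ^ m + real m * t ^ (m - 1) * (card Q - card A * t)"
    using t by simp
  also have "\<dots> = (\<Sum>a\<in>A. t ^ m + real m * t ^ (m - 1) * (card (D a) - t))"
    unfolding sum.distrib sum_distrib_left[symmetric] sum_subtractf cardQ by simp
  also have "\<dots> \<le> (\<Sum>a\<in>A. real (card (D a)) ^ m)"
    using t(1) by (intro sum_mono power_above_tangent) auto
  finally show ?thesis
    by (simp only: count)
qed

text \<open>The \<open>m\<close>-tuples from one side and the points of the other again form a bipartite relation, of
  density at least \<open>p\<^sup>m\<close>, so the one-sided bound applies a second time with the sides exchanged.\<close>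

lemma blow_up_both_sides:
  fixes A :: "'a set" and B :: "'b set" and p :: real
  assumes "finite A" "finite B" "Q \<subseteq> A \<times> B" "0 \<le> p"
    and dense: "p * card A * card B \<le> card Q"
  shows "p ^ (m\<^sup>2) * real (card A) ^ m * real (card B) ^ m
    \<le> card {(b, a). b \<in> {..<m} \<rightarrow>\<^sub>E B \<and> a \<in> {..<m} \<rightarrow>\<^sub>E A \<and>
                    (\<forall>i<m. \<forall>j<m. (a i, b j) \<in> Q)}"
proof -
  define B' where "B' = ({..<m} \<rightarrow>\<^sub>E B)"
  define Q' where "Q' = {(b, a). b \<in> B' \<and> a \<in> A \<and> (\<forall>j<m. (a, b j) \<in> Q)}"
  have "Q' = prod.swap ` {(a, b). a \<in> A \<and> b \<in> B' \<and> (\<forall>j<m. (a, b j) \<in> Q)}"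
    by (auto simp: Q'_def)
  then have "card Q' = card {(a, b). a \<in> A \<and> b \<in> B' \<and> (\<forall>j<m. (a, b j) \<in> Q)}"
    by (simp add: card_image)
  moreover have cardB': "card B' = card B ^ m"
    by (simp add: B'_def card_PiE)
  ultimately have "p ^ m * card B' * card A \<le> card Q'"
    using blow_up_right_side[OF assms, of m] by (simp add: B'_def mult_ac)
  moreover have "finite B'" "Q' \<subseteq> B' \<times> A"
    using assms(2) by (auto simp: B'_def Q'_def finite_PiE)
  ultimately have "(p ^ m) ^ m * card B' * real (card A) ^ m
      \<le> card {(b, a). b \<in> B' \<and> a \<in> {..<m} \<rightarrow>\<^sub>E A \<and> (\<forall>i<m. (b, a i) \<in> Q')}"
    using assms by (intro blow_up_right_side) auto
  moreover have "{(b, a). b \<in> B' \<and> a \<in> {..<m} \<rightarrow>\<^sub>E A \<and> (\<forall>i<m. (b, a i) \<in> Q')}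
      = {(b, a). b \<in> {..<m} \<rightarrow>\<^sub>E B \<and> a \<in> {..<m} \<rightarrow>\<^sub>E A \<and> (\<forall>i<m. \<forall>j<m. (a i, b j) \<in> Q)}"
    by (auto simp: Q'_def B'_def)
  ultimately show ?thesis
    by (simp add: cardB' power2_eq_square power_mult mult_ac)
qed

section \<open>Robust levels of a finite poset\<close>

primrec robust_level :: "'a set \<Rightarrow> ('a \<Rightarrow> 'a \<Rightarrow> bool) \<Rightarrow> real \<Rightarrow> nat \<Rightarrow> 'a set" where
  "robust_level V R t 0 = V"
| "robust_level V R t (Suc j) = {x \<in> V. t \<le> card {y \<in> robust_level V R t j. R y x}}"

lemma robust_level_subset: "robust_level V R t j \<subseteq> V"
  by (cases j) auto

text \<open>The step from one level to the next is a monotone operator on subsets of \<open>V\<close>, and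
  level \<open>1\<close> is contained in \<open>V\<close>, which is level \<open>0\<close>.\<close>

lemma robust_level_decreasing:
  assumes "finite V" "i \<le> j"
  shows "robust_level V R t j \<subseteq> robust_level V R t i"
proof -
  have "robust_level V R t (Suc j) \<subseteq> robust_level V R t j" for j
  proof (induction j)
    case 0
    show ?case by auto
  next
    case (Suc j)
    have "card {y \<in> robust_level V R t (Suc j). R y x} \<le> card {y \<in> robust_level V R t j. R y x}" for x
      using Suc finite_subset[OF robust_level_subset assms(1)] by (intro card_mono) auto
    then show ?case
      by (auto intro: order_trans simp del: robust_level.simps(2)
            simp: robust_level.simps(2)[of V R t "Suc j"] robust_level.simps(2)[of V R t j])
  qed
  then show ?thesis
    using assms(2) lift_Suc_antimono_le by blast
qed

text \<open>By transitivity, everything below \<open>x\<close> is also below \<open>z\<close>.\<close>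

lemma robust_level_upward_closed:
  assumes "finite V" "transp_on V R" "x \<in> robust_level V R t j" "R x z" "z \<in> V"
  shows "z \<in> robust_level V R t j"
proof (cases j)
  case (Suc i)
  have "{y \<in> robust_level V R t i. R y x} \<subseteq> {y \<in> robust_level V R t i. R y z}"
    using assms robust_level_subset[of V R t i] robust_level_subset[of V R t j]
    by (auto dest: transp_onD)
  then have "card {y \<in> robust_level V R t i. R y x} \<le> card {y \<in> robust_level V R t i. R y z}"
    using finite_subset[OF robust_level_subset assms(1)] by (intro card_mono) auto
  then show ?thesis
    using assms Suc by auto
qed (use assms in simp)

text \<open>As the levels are nested, some level containing \<open>x\<close> but not \<open>y\<close> exists exactly when \<open>x\<close>
  reaches a strictly higher level than \<open>y\<close>. Excluding \<open>x\<close> from level \<open>h\<close> excludes \<open>y\<close> as well,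
  since levels are up-sets.\<close>

definition level_crossing ::
  "'a set \<Rightarrow> ('a \<Rightarrow> 'a \<Rightarrow> bool) \<Rightarrow> real \<Rightarrow> nat \<Rightarrow> 'a \<Rightarrow> 'a \<Rightarrow> bool" where
  "level_crossing V R t h y x \<longleftrightarrow>
     R y x \<and> x \<notin> robust_level V R t h \<and>
     (\<exists>j. x \<in> robust_level V R t j \<and> y \<notin> robust_level V R t j)"

lemma transp_on_level_crossing:
  assumes "finite V" "transp_on V R"
  shows "transp_on V (level_crossing V R t h)"
proof (rule transp_onI)
  fix y x z
  assume V: "y \<in> V" "x \<in> V" "z \<in> V"
    and yx: "level_crossing V R t h y x" and xz: "level_crossing V R t h x z"
  obtain j where "x \<in> robust_level V R t j" "y \<notin> robust_level V R t j"
    using yx by (auto simp: level_crossing_def)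
  moreover have "z \<in> robust_level V R t j"
    using calculation robust_level_upward_closed[OF assms] xz V by (auto simp: level_crossing_def)
  ultimately show "level_crossing V R t h y z"
    using yx xz V transp_onD[OF assms(2)] unfolding level_crossing_def by blast
qed

text \<open>The colour of a point counts the levels from \<open>1\<close> to \<open>h - 1\<close> that contain it, so for points
  outside level \<open>h\<close> it is the highest level reached.\<close>

lemma level_crossing_colouring:
  assumes "finite V" "transp_on V R" "0 < h"
  shows "proper_colouring (poset_graph V (level_crossing V R t h)) h
           (\<lambda>x. card {j \<in> {0<..<h}. x \<in> robust_level V R t j})"
proof -
  define c where "c x = card {j \<in> {0<..<h}. x \<in> robust_level V R t j}" for x
  have "c y < c x" if V: "y \<in> V" "x \<in> V" and cr: "level_crossing V R t h y x" for x y
  proof -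
    obtain j where j: "x \<in> robust_level V R t j" "y \<notin> robust_level V R t j"
      using cr by (auto simp: level_crossing_def)
    have "\<not> h \<le> j"
      using cr j robust_level_decreasing[OF assms(1), of h j R t] by (auto simp: level_crossing_def)
    moreover have "j \<noteq> 0"
      using j V by (metis robust_level.simps(1))
    ultimately have "j \<in> {0<..<h}"
      by auto
    moreover have "y \<in> robust_level V R t i \<Longrightarrow> x \<in> robust_level V R t i" for i
      using robust_level_upward_closed[OF assms(1,2)] V cr by (auto simp: level_crossing_def)
    ultimately have "{i \<in> {0<..<h}. y \<in> robust_level V R t i} \<subset> {i \<in> {0<..<h}. x \<in> robust_level V R t i}"
      using j by blast
    then show ?thesis
      unfolding c_def by (intro psubset_card_mono) auto
  qed
  moreover have "c x < h" for x
  proof -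
    have "c x \<le> card {0<..<h}"
      unfolding c_def by (intro card_mono) auto
    then show ?thesis
      using assms(3) by simp
  qed
  ultimately have "proper_colouring (poset_graph V (level_crossing V R t h)) h c"
    unfolding proper_colouring_def adj_def poset_graph_def
    by (auto simp: doubleton_eq_iff) (metis less_irrefl)+
  then show ?thesis
    unfolding c_def[abs_def] .
qed

text \<open>One summand \<open>t |V|\<close> pays for the pairs whose upper element lies in level \<open>h\<close>. The other pays
  for the remaining upper elements \<open>x\<close>: if \<open>i\<close> is the highest level reached by \<open>x\<close>, then the lost
  elements below \<open>x\<close> lie in level \<open>i\<close>, and there are fewer than \<open>t\<close> of those because \<open>x\<close> is not in
  level \<open>i + 1\<close>.\<close>

lemma few_non_crossing_pairs:
  fixes t :: real
  assumes "finite V" "0 \<le> t" and small: "card (robust_level V R t h) \<le> t"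
  shows "card {(y, x) \<in> V \<times> V. R y x \<and> \<not> level_crossing V R t h y x} \<le> 2 * t * card V"
proof -
  define L where "L = robust_level V R t"
  \<comment> \<open>\<open>S x\<close> collects the elements below \<open>x\<close> that reach every level reached by \<open>x\<close>.\<close>
  define S where "S x = {y \<in> V. R y x \<and> (\<forall>j. x \<in> L j \<longrightarrow> y \<in> L j)}" for x
  define T where "T = (SIGMA x:V - L h. S x)"
  have LV: "L j \<subseteq> V" for j
    unfolding L_def by (rule robust_level_subset)
  have S: "card (S x) \<le> t" if x: "x \<in> V - L h" for x
  proof -
    define j where "j = (LEAST j. x \<notin> L j)"
    have "x \<notin> L j"
      using LeastI[of "\<lambda>j. x \<notin> L j" h] x by (simp add: j_def)
    moreover have "x \<in> L 0"
      using x by (simp add: L_def)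
    ultimately obtain i where i: "j = Suc i"
      by (cases j) auto
    have "x \<in> L i"
      using not_less_Least[of i "\<lambda>j. x \<notin> L j"] i by (auto simp: j_def)
    then have "S x \<subseteq> {y \<in> L i. R y x}"
      by (auto simp: S_def)
    then have "card (S x) \<le> card {y \<in> L i. R y x}"
      using finite_subset[OF LV assms(1)] by (intro card_mono) auto
    moreover have "card {y \<in> L i. R y x} < t"
      using \<open>x \<notin> L j\<close> x by (auto simp: i L_def)
    ultimately show ?thesis
      by simp
  qed
  have "{(y, x) \<in> V \<times> V. R y x \<and> \<not> level_crossing V R t h y x} \<subseteq> V \<times> L h \<union> prod.swap ` T"
    by (auto simp: level_crossing_def L_def S_def T_def image_iff)
  moreover have finT: "finite T"
    using assms(1) by (auto simp: T_def S_def)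
  moreover have "finite (V \<times> L h)"
    using assms(1) LV finite_subset by blast
  ultimately have "card {(y, x) \<in> V \<times> V. R y x \<and> \<not> level_crossing V R t h y x}
      \<le> card (V \<times> L h \<union> prod.swap ` T)"
    by (intro card_mono) auto
  also have "\<dots> \<le> card V * card (L h) + card T"
    using card_Un_le[of "V \<times> L h" "prod.swap ` T"] card_image_le[OF finT, of prod.swap]
    by (simp add: card_cartesian_product)
  finally have "real (card {(y, x) \<in> V \<times> V. R y x \<and> \<not> level_crossing V R t h y x})
      \<le> real (card V) * card (L h) + card T"
    unfolding of_nat_add[symmetric] of_nat_mult[symmetric] of_nat_le_iff .
  moreover have "real (card V) * card (L h) \<le> card V * t"
    using small by (intro mult_left_mono) (auto simp: L_def)
  moreover have "real (card T) \<le> card V * t"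
  proof -
    have "real (card T) = (\<Sum>x\<in>V - L h. real (card (S x)))"
      using assms(1) by (simp add: T_def S_def card_SigmaI)
    also have "\<dots> \<le> (\<Sum>x\<in>V - L h. t)"
      using S by (intro sum_mono) auto
    also have "\<dots> \<le> card V * t"
      using assms by (simp add: card_mono mult_right_mono)
    finally show ?thesis .
  qed
  ultimately show ?thesis
    by (simp add: algebra_simps)
qed

section \<open>Chains through the robust levels\<close>

text \<open>Only consecutive entries are compared. On a transitive relation this makes no difference, and
  it lets chains be extended and cut like paths.\<close>

definition chains :: "'a set \<Rightarrow> ('a \<Rightarrow> 'a \<Rightarrow> bool) \<Rightarrow> nat \<Rightarrow> (nat \<Rightarrow> 'a) set" where
  "chains V R k = {f \<in> {..<k} \<rightarrow>\<^sub>E V. \<forall>i. Suc i < k \<longrightarrow> R (f i) (f (Suc i))}"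

lemma finite_chains: "finite V \<Longrightarrow> finite (chains V R k)"
  by (simp add: chains_def finite_PiE)

text \<open>A point of level \<open>h + 1\<close> has at least \<open>t\<close> points of level \<open>h\<close> below it, and every chain that
  ends in one of them can be prolonged to the point.\<close>

lemma many_chains_below:
  fixes t :: real
  assumes "finite V" "0 \<le> t" "x \<in> robust_level V R t h"
  shows "t ^ h \<le> card {f \<in> chains V R (Suc h). f h = x}"
  using assms(3)
proof (induction h arbitrary: x)
  case 0
  then have "(\<lambda>i\<in>{..<Suc 0}. x) \<in> {f \<in> chains V R (Suc 0). f 0 = x}"
    by (auto simp: chains_def)
  then have "card {f \<in> chains V R (Suc 0). f 0 = x} \<noteq> 0"
    using finite_chains[OF assms(1)] by (auto simp: card_eq_0_iff)
  then show ?case by simp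
next
  case (Suc h)
  define Y where "Y = {y \<in> robust_level V R t h. R y x}"
  define C where "C y = {f \<in> chains V R (Suc h). f h = y}" for y
  have xV: "x \<in> V" and Y: "t \<le> card Y"
    using Suc.prems by (auto simp: Y_def)
  have finY: "finite Y"
    using finite_subset[OF robust_level_subset assms(1)] by (auto simp: Y_def)
  have finC: "finite (C y)" for y
    using finite_chains[OF assms(1)] by (auto simp: C_def)
  define ext where "ext f = f(Suc h := x)" for f :: "nat \<Rightarrow> 'a"
  have inj: "inj_on ext (\<Union>y\<in>Y. C y)"
  proof (rule inj_onI)
    fix f g
    assume fg: "f \<in> (\<Union>y\<in>Y. C y)" "g \<in> (\<Union>y\<in>Y. C y)" and eq: "ext f = ext g"
    have "f i = g i" if "i \<noteq> Suc h" for i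
      using fun_cong[OF eq, of i] that by (simp add: ext_def)
    moreover have "f (Suc h) = undefined" "g (Suc h) = undefined"
      using fg by (auto simp: C_def chains_def PiE_iff extensional_def)
    ultimately show "f = g"
      by (metis ext)
  qed
  have "ext ` (\<Union>y\<in>Y. C y) \<subseteq> {f \<in> chains V R (Suc (Suc h)). f (Suc h) = x}"
    using xV by (auto simp: ext_def C_def Y_def chains_def PiE_iff extensional_def less_Suc_eq)
  then have "card (\<Union>y\<in>Y. C y) \<le> card {f \<in> chains V R (Suc (Suc h)). f (Suc h) = x}"
    using finite_chains[OF assms(1)] inj by (intro card_inj_on_le[of ext]) auto
  moreover have "card (\<Union>y\<in>Y. C y) = (\<Sum>y\<in>Y. card (C y))"
    using finY finC by (intro card_UN_disjoint) (auto simp: C_def)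
  moreover have "t ^ Suc h \<le> (\<Sum>y\<in>Y. real (card (C y)))"
  proof -
    have "t ^ Suc h \<le> card Y * t ^ h"
      using Y assms(2) by (simp add: mult_right_mono)
    also have "\<dots> = (\<Sum>y\<in>Y. t ^ h)"
      by simp
    also have "\<dots> \<le> (\<Sum>y\<in>Y. real (card (C y)))"
      using Suc.IH by (intro sum_mono) (auto simp: Y_def C_def)
    finally show ?thesis .
  qed
  ultimately show ?case
    by (simp flip: of_nat_sum)
qed

lemma many_chains:
  fixes t :: real
  assumes "finite V" "0 < t" and big: "t < card (robust_level V R t h)"
  shows "t ^ Suc h < card (chains V R (Suc h))"
proof -
  define L where "L = robust_level V R t h"
  define C where "C x = {f \<in> chains V R (Suc h). f h = x}" for x
  have finL: "finite L"
    unfolding L_def by (rule finite_subset[OF robust_level_subset assms(1)])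
  have finC: "finite (C x)" for x
    using finite_chains[OF assms(1)] by (auto simp: C_def)
  have "t ^ Suc h < card L * t ^ h"
    using big assms(2) by (simp add: L_def)
  also have "\<dots> = (\<Sum>x\<in>L. t ^ h)"
    by simp
  also have "\<dots> \<le> (\<Sum>x\<in>L. real (card (C x)))"
    using many_chains_below[OF assms(1)] assms(2) by (intro sum_mono) (auto simp: L_def C_def)
  also have "\<dots> = card (\<Union>x\<in>L. C x)"
    using finL finC by (subst card_UN_disjoint) (auto simp: C_def)
  also have "\<dots> \<le> card (chains V R (Suc h))"
    using finite_chains[OF assms(1)] by (auto intro!: card_mono simp: C_def)
  finally show ?thesis .
qed

section \<open>Blown-up chains\<close>

text \<open>Homomorphic images, respecting the order of the parts, of the complete \<open>k\<close>-partite graph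
  with parts of size \<open>m\<close>: the point \<open>(j, i)\<close> is the \<open>i\<close>-th vertex of part \<open>j\<close>.\<close>

definition chain_blow_ups ::
  "'a set \<Rightarrow> ('a \<Rightarrow> 'a \<Rightarrow> bool) \<Rightarrow> nat \<Rightarrow> nat \<Rightarrow> (nat \<times> nat \<Rightarrow> 'a) set" where
  "chain_blow_ups V R k m = {g \<in> {..<k} \<times> {..<m} \<rightarrow>\<^sub>E V.
     \<forall>i<m. \<forall>i'<m. \<forall>j<k. \<forall>j'<k. j < j' \<longrightarrow> R (g (j, i)) (g (j', i'))}"

text \<open>Restricting chains to even and to odd positions turns them into a bipartite relation \<open>Q\<close> of
  the same density. Suppose that \<open>m\<close> restrictions of the one kind and \<open>m\<close> of the other are pairwise
  related. Any two points in consecutive blocks then lie on a common chain, and transitivity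
  extends the comparison to all pairs of blocks.\<close>

lemma many_chain_blow_ups:
  fixes p :: real
  assumes "finite V" "transp_on V R" "0 \<le> p"
    and dense: "p * real (card V) ^ k \<le> card (chains V R k)"
  shows "p ^ (m\<^sup>2) * real (card V) ^ (k * m) \<le> card (chain_blow_ups V R k m)"
proof -
  define Ev where "Ev = {j. j < k \<and> even j}"
  define Od where "Od = {j. j < k \<and> odd j}"
  define A where "A = (Ev \<rightarrow>\<^sub>E V)"
  define B where "B = (Od \<rightarrow>\<^sub>E V)"
  define split where "split f = (restrict f Ev, restrict f Od)" for f :: "nat \<Rightarrow> 'a"
  define Q where "Q = split ` chains V R k"
  define W where "W = {(b, a). b \<in> {..<m} \<rightarrow>\<^sub>E B \<and> a \<in> {..<m} \<rightarrow>\<^sub>E A \<and>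
                    (\<forall>i<m. \<forall>i'<m. (a i, b i') \<in> Q)}"
  define merge where "merge = (\<lambda>(b, a). \<lambda>(j, i)\<in>{..<k} \<times> {..<m}.
     if even j then a i j else b i j :: 'a)"
  have fin: "finite Ev" "finite Od" and EO: "Ev \<union> Od = {..<k}" "Ev \<inter> Od = {}"
    by (auto simp: Ev_def Od_def)
  have cardEO: "card Ev + card Od = k"
    using card_Un_disjoint[OF fin EO(2)] EO(1) by simp
  have cardAB: "card A = card V ^ card Ev" "card B = card V ^ card Od"
    using fin by (simp_all add: A_def B_def card_PiE)
  have "inj_on split (chains V R k)"
  proof (rule inj_onI)
    fix f g
    assume fg: "f \<in> chains V R k" "g \<in> chains V R k" and eq: "split f = split g"
    show "f = g"
    proof
      fix j
      show "f j = g j"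
      proof (cases "j < k")
        case True
        then show ?thesis
          using eq unfolding split_def prod.inject
          by (cases "even j") (metis (mono_tags, lifting) Ev_def Od_def mem_Collect_eq restrict_apply')+
      next
        case False
        then show ?thesis
          using fg by (auto simp: chains_def PiE_iff extensional_def)
      qed
    qed
  qed
  then have "card Q = card (chains V R k)"
    by (simp add: Q_def card_image)
  moreover have "real (card V) ^ k = card A * card B"
    using power_add[of "real (card V)" "card Ev" "card Od"] by (simp add: cardAB cardEO)
  ultimately have "p * card A * card B \<le> card Q"
    using dense by (simp add: mult_ac)
  moreover have "Q \<subseteq> A \<times> B"
    by (auto simp: Q_def split_def A_def B_def chains_def restrict_PiE_iff Ev_def Od_def dest: PiE_mem)
  moreover have "finite A" "finite B"
    using fin assms(1) by (simp_all add: A_def B_def finite_PiE)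
  ultimately have "p ^ (m\<^sup>2) * real (card A) ^ m * real (card B) ^ m \<le> card W"
    unfolding W_def using assms(3) by (intro blow_up_both_sides) auto
  moreover have "real (card A) ^ m * real (card B) ^ m = real (card V) ^ (k * m)"
    using \<open>real (card V) ^ k = card A * card B\<close> by (simp add: power_mult power_mult_distrib)
  ultimately have "p ^ (m\<^sup>2) * real (card V) ^ (k * m) \<le> card W"
    by (metis mult.assoc)
  moreover have "card W \<le> card (chain_blow_ups V R k m)"
  proof (rule card_inj_on_le)
    show "inj_on merge W"
    proof (rule inj_onI)
      fix u v
      assume uv: "u \<in> W" "v \<in> W" and eq: "merge u = merge v"
      obtain b a b' a' where u: "u = (b, a)" and v: "v = (b', a')"
        by fastforce
      have *: "(if even j then a i j else b i j) = (if even j then a' i j else b' i j)"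
        if "j < k" "i < m" for i j
        using fun_cong[OF eq, of "(j, i)"] that by (simp add: merge_def u v)
      have "a = a'"
      proof (rule PiE_ext[of a "{..<m}" "\<lambda>_. A" a'])
        fix i assume i: "i \<in> {..<m}"
        show "a i = a' i"
        proof (rule PiE_ext)
          show "a i \<in> Ev \<rightarrow>\<^sub>E V" "a' i \<in> Ev \<rightarrow>\<^sub>E V"
            using uv i by (auto simp: W_def u v A_def)
          show "a i j = a' i j" if "j \<in> Ev" for j
            using that *[of j i] i by (simp add: Ev_def)
        qed
      qed (use uv in \<open>auto simp: W_def u v\<close>)
      moreover have "b = b'"
      proof (rule PiE_ext[of b "{..<m}" "\<lambda>_. B" b'])
        fix i assume i: "i \<in> {..<m}"
        show "b i = b' i"
        proof (rule PiE_ext)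
          show "b i \<in> Od \<rightarrow>\<^sub>E V" "b' i \<in> Od \<rightarrow>\<^sub>E V"
            using uv i by (auto simp: W_def u v B_def)
          show "b i j = b' i j" if "j \<in> Od" for j
            using that *[of j i] i by (simp add: Od_def)
        qed
      qed (use uv in \<open>auto simp: W_def u v\<close>)
      ultimately show "u = v"
        by (simp add: u v)
    qed
    show "merge ` W \<subseteq> chain_blow_ups V R k m"
    proof clarify
      fix b a
      assume ba: "(b, a) \<in> W"
      define g where "g = merge (b, a)"
      have g: "g (j, i) = (if even j then a i j else b i j)" if "j < k" "i < m" for i j
        using that by (simp add: g_def merge_def)
      have gV: "g \<in> {..<k} \<times> {..<m} \<rightarrow>\<^sub>E V"
        using ba by (auto simp: g_def merge_def W_def A_def B_def Ev_def Od_def PiE_iff Pi_iff)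
      have step: "R (g (j, i)) (g (Suc j, i'))" if "Suc j < k" "i < m" "i' < m" for i i' j
      proof -
        \<comment> \<open>The chain must use the copy \<open>i\<close> at position \<open>j\<close> and the copy \<open>i'\<close> at position \<open>j + 1\<close>; which of
            them belongs to the even side depends on the parity of \<open>j\<close>.\<close>
        have "\<exists>f \<in> chains V R k. a l = restrict f Ev \<and> b l' = restrict f Od" if "l < m" "l' < m" for l l'
        proof -
          have "(a l, b l') \<in> Q"
            using ba that by (simp add: W_def)
          then show ?thesis
            by (auto simp: Q_def split_def)
        qed
        moreover have "(if even j then i else i') < m" "(if even j then i' else i) < m"
          using that by auto
        ultimately obtain f where f: "f \<in> chains V R k"
          "a (if even j then i else i') = restrict f Ev" "b (if even j then i' else i) = restrict f Od"
          by blast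
        have "g (j, i) = f j" "g (Suc j, i') = f (Suc j)"
          using that f(2,3) by (auto simp: g Ev_def Od_def split: if_splits)
        moreover have "R (f j) (f (Suc j))"
          using f(1) that by (auto simp: chains_def)
        ultimately show ?thesis
          by simp
      qed
      have "R (g (j, i)) (g (j', i'))" if j: "j < j'" "j' < k" and i: "i < m" "i' < m" for i i' j j'
        using j
      proof (induction j' rule: less_induct)
        case (less j')
        then obtain l where l: "j' = Suc l" "j \<le> l"
          by (metis less_Suc_eq_le less_imp_Suc_add add_Suc_right le_add1)
        show ?case
        proof (cases "j = l")
          case True
          then show ?thesis
            using step l less.prems i by auto
        next
          case False
          then have "R (g (j, i)) (g (l, i'))" "R (g (l, i')) (g (j', i'))"
            using less step l i by auto
          moreover have "g (j, i) \<in> V" "g (l, i') \<in> V" "g (j', i') \<in> V"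
            using gV less.prems l i by (auto simp: PiE_iff)
          ultimately show ?thesis
            using transp_onD[OF assms(2)] by blast
        qed
      qed
      then show "merge (b, a) \<in> chain_blow_ups V R k m"
        using gV by (auto simp: chain_blow_ups_def g_def)
    qed
    show "finite (chain_blow_ups V R k m)"
      using assms(1) by (simp add: chain_blow_ups_def finite_PiE)
  qed
  ultimately show ?thesis
    by linarith
qed

section \<open>Homomorphisms into a comparability graph\<close>

lemma chromatic_number_le: "proper_colouring F k c \<Longrightarrow> chromatic_number F \<le> k"
  unfolding chromatic_number_def by (rule Least_le) blast

lemma ex_colouring_chromatic_number:
  assumes "finite_simple_graph F"
  shows "\<exists>c. proper_colouring F (chromatic_number F) c"
proof -
  obtain c :: "'a \<Rightarrow> nat" and n where c: "c ` verts F = {i. i < n}" "inj_on c (verts F)"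
    using assms finite_imp_inj_to_nat_seg unfolding finite_simple_graph_def by metis
  have "x \<noteq> y" if "adj F x y" for x y
    using assms that by (force simp: adj_def finite_simple_graph_def simple_graph_def)
  then have "proper_colouring F n c"
    using c by (fastforce simp: proper_colouring_def inj_on_eq_iff)
  then show ?thesis
    unfolding chromatic_number_def by (rule LeastI[of "\<lambda>k. \<exists>c. proper_colouring F k c", OF exI])
qed

lemma card_independent_set_le:
  assumes "finite (verts F)" "independent_set F S"
  shows "card S \<le> independence_number F"
proof -
  have "{S. independent_set F S} \<subseteq> Pow (verts F)"
    by (auto simp: independent_set_def)
  then have "finite {S. independent_set F S}"
    using assms(1) finite_subset by auto
  then show ?thesis
    using assms(2) unfolding independence_number_def by (intro Max_ge) auto
qed

lemma hom_density_eq: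
  assumes "finite (verts F)" "finite (verts G)"
  shows "hom_density F G = card {f \<in> verts F \<rightarrow>\<^sub>E verts G. graph_hom F G f}
                             / real (card (verts G)) ^ card (verts F)"
  using assms unfolding hom_density_def
  by (subst measure_uniform_count_measure) (auto simp: finite_PiE card_PiE)

lemma finite_embedding_by_colour_classes:
  assumes "finite W" and classes: "\<And>j. card {v \<in> W. c v = j} \<le> m"
  shows "\<exists>\<iota> :: 'a \<Rightarrow> nat. (\<forall>v\<in>W. \<iota> v < m) \<and> inj_on (\<lambda>v. (c v, \<iota> v)) W"
proof -
  have "\<exists>h. h ` {v \<in> W. c v = j} \<subseteq> {..<m} \<and> inj_on h {v \<in> W. c v = j}" for j
    using assms card_le_inj[of "{v \<in> W. c v = j}" "{..<m}"] by auto
  then obtain h where h: "\<And>j. h j ` {v \<in> W. c v = j} \<subseteq> {..<m}" "\<And>j. inj_on (h j) {v \<in> W. c v = j}"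
    by metis
  have "inj_on (\<lambda>v. (c v, h (c v) v)) W"
  proof (rule inj_onI)
    fix u v assume "u \<in> W" "v \<in> W" "(c u, h (c u) u) = (c v, h (c v) v)"
    then show "u = v"
      using inj_onD[OF h(2)[of "c v"], of u v] by auto
  qed
  then show ?thesis
    using h(1) by (intro exI[of _ "\<lambda>v. h (c v) v"]) auto
qed

text \<open>A function on \<open>I\<close> is determined by its pull-back along \<open>e\<close> and its values off the image of
  \<open>e\<close>. In terms of densities, restricting to some of the coordinates cannot decrease the density of
  a set of functions.\<close>

lemma card_PiE_le_card_projection:
  assumes "finite I" "finite V" "\<G> \<subseteq> I \<rightarrow>\<^sub>E V" "inj_on e W" "e ` W \<subseteq> I" "finite W"
  shows "card \<G> \<le> card ((\<lambda>g. restrict (g \<circ> e) W) ` \<G>) * card V ^ (card I - card W)"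
proof -
  define \<pi> where "\<pi> g = (restrict (g \<circ> e) W, restrict g (I - e ` W))" for g :: "'a \<Rightarrow> 'b"
  have fin: "finite \<G>"
    using assms finite_subset finite_PiE by metis
  have "inj_on \<pi> \<G>"
  proof (rule inj_onI)
    fix f g assume fg: "f \<in> \<G>" "g \<in> \<G>" and eq: "\<pi> f = \<pi> g"
    have "f i = g i" if "i \<in> I" for i
    proof (cases "i \<in> e ` W")
      case True
      then obtain w where "w \<in> W" "i = e w"
        by blast
      then show ?thesis
        using eq unfolding \<pi>_def prod.inject by (metis comp_apply restrict_apply')
    next
      case False
      then show ?thesis
        using eq that unfolding \<pi>_def prod.inject by (metis DiffI restrict_apply')
    qed
    then show "f = g"
      using fg assms(3) by (intro PiE_ext[of f I "\<lambda>_. V" g]) auto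
  qed
  moreover have "\<pi> ` \<G> \<subseteq> (\<lambda>g. restrict (g \<circ> e) W) ` \<G> \<times> (I - e ` W \<rightarrow>\<^sub>E V)"
    using assms(3) by (fastforce simp: \<pi>_def restrict_PiE_iff)
  ultimately have "card \<G> \<le> card ((\<lambda>g. restrict (g \<circ> e) W) ` \<G> \<times> (I - e ` W \<rightarrow>\<^sub>E V))"
    using fin assms by (intro card_inj_on_le[of \<pi>]) (auto intro!: finite_PiE)
  moreover have "card (I - e ` W) = card I - card W"
    using assms by (simp add: card_Diff_subset card_image)
  ultimately show ?thesis
    using assms(1) by (simp add: card_cartesian_product card_PiE)
qed

text \<open>Colour classes are independent, so a vertex is determined by its colour and a number below the
  independence number. Pulling a blown-up chain back along this embedding gives a homomorphism,
  because adjacent vertices go to different parts.\<close>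

lemma hom_density_ge_power:
  fixes p :: real
  assumes F: "finite_simple_graph F" and V: "finite V" "V \<noteq> {}" and "transp_on V R" "0 \<le> p"
    and dense: "p * real (card V) ^ chromatic_number F \<le> card (chains V R (chromatic_number F))"
  shows "p ^ ((independence_number F)\<^sup>2) \<le> hom_density F (poset_graph V R)"
proof -
  define k where "k = chromatic_number F"
  define m where "m = independence_number F"
  define n where "n = card V"
  define I where "I = {..<k} \<times> {..<m}"
  define \<G> where "\<G> = chain_blow_ups V R k m"
  define Hom where "Hom = {f \<in> verts F \<rightarrow>\<^sub>E V. graph_hom F (poset_graph V R) f}"
  have finF: "finite (verts F)"
    using F by (simp add: finite_simple_graph_def)
  obtain c where c: "proper_colouring F k c"
    using ex_colouring_chromatic_number[OF F] by (auto simp: k_def)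
  have "independent_set F {v \<in> verts F. c v = j}" for j
    using c by (force simp: independent_set_def proper_colouring_def)
  then have "card {v \<in> verts F. c v = j} \<le> m" for j
    using card_independent_set_le[OF finF] by (simp add: m_def)
  then obtain \<iota> :: "'a \<Rightarrow> nat" where \<iota>: "\<forall>v\<in>verts F. \<iota> v < m" "inj_on (\<lambda>v. (c v, \<iota> v)) (verts F)"
    using finite_embedding_by_colour_classes[OF finF, of c m] by blast
  define e where "e = (\<lambda>v. (c v, \<iota> v))"
  have e: "inj_on e (verts F)" "e ` verts F \<subseteq> I"
    using \<iota> c by (auto simp: e_def I_def proper_colouring_def)
  have "finite I" "card I = k * m"
    by (simp_all add: I_def card_cartesian_product)
  have \<G>I: "\<G> \<subseteq> I \<rightarrow>\<^sub>E V"
    by (auto simp: \<G>_def chain_blow_ups_def I_def)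
  have leI: "card (verts F) \<le> card I"
    using card_inj_on_le[OF e] \<open>finite I\<close> by simp
  have "(\<lambda>g. restrict (g \<circ> e) (verts F)) ` \<G> \<subseteq> Hom"
  proof clarify
    fix g assume g: "g \<in> \<G>"
    have gV: "g (e v) \<in> V" if "v \<in> verts F" for v
      using g \<G>I e(2) that by (auto simp: PiE_iff)
    have "R (g (e u)) (g (e v)) \<or> R (g (e v)) (g (e u))"
      if uv: "u \<in> verts F" "v \<in> verts F" "adj F u v" for u v
    proof -
      have "c u \<noteq> c v" "c u < k" "c v < k" "\<iota> u < m" "\<iota> v < m"
        using uv c \<iota> by (auto simp: proper_colouring_def)
      then show ?thesis
        using g by (auto simp: \<G>_def chain_blow_ups_def e_def neq_iff)
    qed
    then show "restrict (g \<circ> e) (verts F) \<in> Hom"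
      using gV by (auto simp: Hom_def graph_hom_def poset_graph_def adj_def) blast+
  qed
  moreover have "finite Hom"
    using finF V by (auto simp: Hom_def intro!: finite_PiE)
  ultimately have "card ((\<lambda>g. restrict (g \<circ> e) (verts F)) ` \<G>) \<le> card Hom"
    by (rule card_mono[rotated])
  then have "card \<G> \<le> card Hom * n ^ (card I - card (verts F))"
    using card_PiE_le_card_projection[OF \<open>finite I\<close> V(1) \<G>I e finF]
    by (auto simp: n_def intro: order_trans mult_right_mono)
  then have "real (card \<G>) \<le> card Hom * real n ^ (card I - card (verts F))"
    unfolding of_nat_power[symmetric] of_nat_mult[symmetric] of_nat_le_iff .
  moreover have "p ^ (m\<^sup>2) * real n ^ card I \<le> card \<G>"
    using many_chain_blow_ups[of V R p k m] assms by (simp add: \<G>_def n_def k_def \<open>card I = k * m\<close>)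
  moreover have "real n ^ card I = real n ^ card (verts F) * real n ^ (card I - card (verts F))"
    using leI by (simp flip: power_add)
  ultimately have "(p ^ (m\<^sup>2) * real n ^ card (verts F)) * real n ^ (card I - card (verts F))
      \<le> card Hom * real n ^ (card I - card (verts F))"
    by (simp add: mult.assoc)
  moreover have "0 < n"
    using V by (simp add: n_def card_gt_0_iff)
  ultimately have "p ^ (m\<^sup>2) * real n ^ card (verts F) \<le> card Hom"
    by simp
  then have "p ^ (m\<^sup>2) \<le> card Hom / real n ^ card (verts F)"
    using \<open>0 < n\<close> by (simp add: pos_le_divide_eq)
  then show ?thesis
    using hom_density_eq[OF finF, of "poset_graph V R"] V
    by (simp add: Hom_def n_def m_def poset_graph_def)
qed

section \<open>Removal\<close>

lemma colouring_pullback: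
  assumes "subgraph S H" "bij_betw f (verts F) (verts S)"
    "\<forall>x\<in>verts F. \<forall>y\<in>verts F. adj F x y \<longleftrightarrow> adj S (f x) (f y)" "proper_colouring H k c"
  shows "proper_colouring F k (c \<circ> f)"
proof -
  have fH: "f x \<in> verts H" if "x \<in> verts F" for x
    using assms(1,2) that by (auto simp: subgraph_def bij_betw_def)
  moreover have "adj H (f x) (f y)" if "x \<in> verts F" "y \<in> verts F" "adj F x y" for x y
    using assms(1,3) that by (auto simp: subgraph_def adj_def)
  ultimately show ?thesis
    using assms(4) by (simp add: proper_colouring_def)
qed

lemma graph_free_if_colourable:
  assumes "proper_colouring H k c" "k < chromatic_number F"
  shows "graph_free F H"
proof (rule ccontr)
  assume "\<not> graph_free F H"
  then obtain S f where "subgraph S H" "bij_betw f (verts F) (verts S)"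
    "\<forall>x\<in>verts F. \<forall>y\<in>verts F. adj F x y \<longleftrightarrow> adj S (f x) (f y)"
    unfolding graph_free_def graph_isomorphic_def by blast
  from colouring_pullback[OF this assms(1)] show False
    using chromatic_number_le assms(2) by (meson leD)
qed

lemma chromatic_number_complete_graph: "chromatic_number (complete_graph r) = r"
proof -
  have verts_complete: "verts (complete_graph r) = {..<r}"
    by (simp add: complete_graph_def)
  have adj: "adj (complete_graph r) x y" if "x < r" "y < r" "x \<noteq> y" for x y
    using that by (simp add: adj_def complete_graph_def)
  have "proper_colouring (complete_graph r) r id"
    by (auto simp: proper_colouring_def adj_def complete_graph_def)
  moreover have "r \<le> k" if c: "proper_colouring (complete_graph r) k c" for k c
  proof -
    have "inj_on c {..<r}"
      using c adj by (force simp: inj_on_def proper_colouring_def verts_complete)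
    moreover have "c ` {..<r} \<subseteq> {..<k}"
      using c by (auto simp: proper_colouring_def complete_graph_def)
    ultimately show ?thesis
      using card_inj_on_le[of c "{..<r}" "{..<k}"] by simp
  qed
  ultimately show ?thesis
    unfolding chromatic_number_def by (intro Least_equality) auto
qed

text \<open>The removal statement for chains: few chains of length \<open>h + 1\<close> force the top level \<open>h\<close> to be
  small, and then only few pairs fail to be level-crossing. The factor \<open>2\<close> is the reason for
  \<open>\<epsilon> / 2\<close> in the corollary.\<close>

lemma comparability_removal:
  fixes \<delta> :: real
  assumes V: "finite V" and R: "irreflp_on V R" "transp_on V R"
    and "0 < \<delta>" "0 < h" and few: "card (chains V R (Suc h)) \<le> (\<delta> * card V) ^ Suc h"
  obtains H c where "spanning_subgraph H (poset_graph V R)" "comparability_graph H"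
    "proper_colouring H h c"
    "real (card (edges (poset_graph V R) - edges H)) \<le> 2 * \<delta> * (real (card V))\<^sup>2"
proof
  define t where "t = \<delta> * card V"
  define R' where "R' = level_crossing V R t h"
  define H where "H = poset_graph V R'"
  have sub: "R y x" if "R' y x" for x y
    using that by (simp add: R'_def level_crossing_def)
  have "simple_graph H"
    using R(1) sub by (fastforce simp: simple_graph_def H_def poset_graph_def irreflp_on_def
        card_insert_if)
  then show "spanning_subgraph H (poset_graph V R)"
    using sub by (auto simp: spanning_subgraph_def subgraph_def H_def poset_graph_def)
  have "irreflp_on V R'"
    using R(1) sub by (auto simp: irreflp_on_def)
  then show "comparability_graph H"
    using transp_on_level_crossing[OF V R(2)] by (auto simp: comparability_graph_def H_def R'_def)
  show "proper_colouring H h (\<lambda>x. card {j \<in> {0<..<h}. x \<in> robust_level V R t j})"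
    unfolding H_def R'_def using assms by (intro level_crossing_colouring)
  have t: "0 \<le> t"
    using assms by (simp add: t_def)
  have "card (robust_level V R t h) \<le> t"
  proof (cases "V = {}")
    case True
    then show ?thesis
      using robust_level_subset[of V R t h] t by simp
  next
    case False
    then have "0 < t"
      using V assms by (simp add: t_def card_gt_0_iff)
    then show ?thesis
      using many_chains[OF V, of t R h] few by (force simp: t_def)
  qed
  then have "card {(y, x) \<in> V \<times> V. R y x \<and> \<not> R' y x} \<le> 2 * t * card V"
    unfolding R'_def using V t by (intro few_non_crossing_pairs)
  moreover have "card (edges (poset_graph V R) - edges H) \<le> card {(y, x) \<in> V \<times> V. R y x \<and> \<not> R' y x}"
  proof (rule surj_card_le)
    show "finite {(y, x) \<in> V \<times> V. R y x \<and> \<not> R' y x}"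
      using V by (auto intro: finite_subset[of _ "V \<times> V"])
    show "edges (poset_graph V R) - edges H \<subseteq> (\<lambda>(y, x). {y, x}) ` {(y, x) \<in> V \<times> V. R y x \<and> \<not> R' y x}"
    proof
      fix e assume e: "e \<in> edges (poset_graph V R) - edges H"
      then obtain x y where xy: "e = {y, x}" "x \<in> V" "y \<in> V" "R y x"
        by (auto simp: poset_graph_def insert_commute)
      then have "\<not> R' y x"
        using e by (auto simp: H_def poset_graph_def)
      then show "e \<in> (\<lambda>(y, x). {y, x}) ` {(y, x) \<in> V \<times> V. R y x \<and> \<not> R' y x}"
        using xy by (intro image_eqI[of _ _ "(y, x)"]) auto
    qed
  qed
  ultimately show "real (card (edges (poset_graph V R) - edges H)) \<le> 2 * \<delta> * (real (card V))\<^sup>2"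
    by (simp add: t_def power2_eq_square mult_ac)
qed

theorem corollary4p2:
  fixes \<F> :: "'a sgraph set" and F :: "'a sgraph" and G :: "'b sgraph" and \<epsilon> :: real
  assumes "\<forall>F'\<in>\<F>. finite_simple_graph F'"
    and "family_chromatic_number \<F> \<ge> 2"
    and "F \<in> \<F>"
    and "chromatic_number F = family_chromatic_number \<F>"
    and "independence_number F = family_independence_number \<F>"
    and "\<epsilon> > 0"
    and "finite (verts G)"
    and "comparability_graph G"
    and "hom_density F G
           \<le> (\<epsilon> / 2) ^ (family_chromatic_number \<F> * (family_independence_number \<F>)\<^sup>2)"
  shows "\<exists>H. spanning_subgraph H G \<and> comparability_graph H \<and>
           family_free \<F> H \<and> graph_free (complete_graph (family_chromatic_number \<F>)) H \<and>
           real (card (edges G - edges H)) \<le> \<epsilon> * (real (card (verts G)))\<^sup>2"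
proof -
  define k where "k = chromatic_number F"
  define m where "m = independence_number F"
  define \<delta> where "\<delta> = \<epsilon> / 2"
  obtain V R where R: "irreflp_on V R" "transp_on V R" and G: "G = poset_graph V R"
    using assms(8) by (auto simp: comparability_graph_def)
  have V: "verts G = V" "finite V"
    using assms(7) by (simp_all add: G poset_graph_def)
  have k: "2 \<le> k"
    using assms(2,4) by (simp add: k_def)
  have F: "finite_simple_graph F"
    using assms(1,3) by blast
  have \<delta>: "0 < \<delta>"
    using assms(6) by (simp add: \<delta>_def)
  have few: "card (chains V R k) \<le> (\<delta> * card V) ^ k"
  proof (rule ccontr)
    assume "\<not> ?thesis"
    then have many: "(\<delta> * card V) ^ k < card (chains V R k)"
      by simp
    have "V \<noteq> {}"
    proof
      assume "V = {}"
      then have "chains V R k = {}"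
        using k by (auto simp: chains_def PiE_iff intro: exI[of _ 0])
      then show False
        using many \<open>V = {}\<close> k by simp
    qed
    \<comment> \<open>The hypothesis on \<open>t(F,G)\<close> is not strict, so strictness has to be carried along: it holds for the
        density \<open>p\<close> and survives taking powers because the exponent is positive.\<close>
    define p where "p = card (chains V R k) / real (card V) ^ k"
    have n: "0 < real (card V)"
      using V(2) \<open>V \<noteq> {}\<close> by (simp add: card_gt_0_iff)
    have p: "p * real (card V) ^ k = card (chains V R k)" "\<delta> ^ k < p"
      using n many by (simp_all add: p_def pos_less_divide_eq power_mult_distrib)
    have "0 < m"
    proof -
      have "verts F \<noteq> {}"
        using k chromatic_number_le[of F 0 "\<lambda>_. 0"] by (auto simp: k_def proper_colouring_def)
      then obtain v where "v \<in> verts F"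
        by blast
      then have "independent_set F {v}"
        using F by (auto simp: independent_set_def finite_simple_graph_def simple_graph_def adj_def)
      then show ?thesis
        using card_independent_set_le[of F "{v}"] F by (simp add: m_def finite_simple_graph_def)
    qed
    have "\<delta> ^ (k * m\<^sup>2) = (\<delta> ^ k) ^ (m\<^sup>2)"
      by (simp add: power_mult)
    also have "\<dots> < p ^ (m\<^sup>2)"
      using p(2) \<delta> \<open>0 < m\<close> by (intro power_strict_mono) auto
    also have "\<dots> \<le> hom_density F G"
      unfolding G m_def using p V(2) \<open>V \<noteq> {}\<close> R \<delta> F less_imp_le[OF less_trans[OF zero_less_power[OF \<delta>] p(2)]]
      by (intro hom_density_ge_power) (auto simp: k_def)
    finally show False
      using assms(4,5,9) by (simp add: \<delta>_def k_def m_def)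
  qed
  obtain h where h: "k = Suc h" "0 < h"
    using k by (cases k) auto
  obtain H c where H: "spanning_subgraph H G" "comparability_graph H" "proper_colouring H h c"
    "real (card (edges G - edges H)) \<le> 2 * \<delta> * (real (card V))\<^sup>2"
    using comparability_removal[OF V(2) R \<delta> h(2)] few unfolding G h(1) by metis
  have "h < chromatic_number F'" if "F' \<in> \<F>" for F'
  proof -
    have "k \<le> chromatic_number F'"
      unfolding k_def assms(4) family_chromatic_number_def using that by (intro cInf_lower) auto
    then show ?thesis
      by (simp add: h)
  qed
  then have "family_free \<F> H"
    by (simp add: family_free_def graph_free_if_colourable[OF H(3)])
  moreover have "graph_free (complete_graph (family_chromatic_number \<F>)) H"
    using h assms(4)
    by (intro graph_free_if_colourable[OF H(3)]) (simp add: chromatic_number_complete_graph k_def)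
  moreover have "real (card (edges G - edges H)) \<le> \<epsilon> * (real (card (verts G)))\<^sup>2"
    using H(4) by (simp add: \<delta>_def V)
  ultimately show ?thesis
    using H(1,2) by blast
qed

end
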